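(* Let $t\ge4$ be an integer, and let $s=\lfloor t/2\rfloor$. Set $A=\{0,1,\dots,s\}\cup\{2s,3s,\dots,s^2\}$ if $t$ is even, and $A=\{0,1,\dots,s\}\cup\{2s,3s,\dots,s^2,(s+1)s\}$ if $t$ is odd (where $2s,3s,\dots$ are consecutive multiples of $s$). Put $S=S(n(A),A)$, i.e. $S=\bigl(\{x\in\mathbb{N}\mid x\ge n(A)\}\cup\{0\}\bigr)\setminus\{(2n(A)-1)-a\mid a\in A\}$. Then the following hold: (1) $|A|=t$; (2) $n(A)=s^2+s+1=\frac{t^2}{4}+\frac{t}{2}+1$ if $t$ is even, and $n(A)=s^2+2s+1=\frac{t^2}{4}+\frac{t}{2}+\frac14$ if $t$ is odd. In particular, $\max A+2\le n(A)$; (3) if $t\ge9$, then $3(t-1)<n(A)$; (4) $S$ is a far-flung Gorenstein numerical semigroup with $s(S)=t(S)=t$. Moreover, if $t\ge9$, then $\mathrm{res}(S)>\ell(S)$.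
   Context: $\mathbb{N}$ denotes the non-negative integers. For integers $x\le y$, $[x,y]=\{z\in\mathbb{Z}\mid x\le z\le y\}$. For sets of integers, $A+B=\{a+b\mid a\in A,b\in B\}$ and $I-J=\{z\in\mathbb{Z}\mid z+y\in I\text{ for all }y\in J\}$ (set difference is written $\setminus$). A numerical semigroup is a submonoid $S$ of $(\mathbb{N},+)$ with $\mathbb{N}\setminus S$ finite. Its multiplicity $m(S)$ is the smallest element of $S\setminus\{0\}$; its Frobenius number $F(S)$ is the largest integer in $\mathbb{Z}\setminus S$. $PF(S)=\{x\in\mathbb{Z}\setminus S\mid x+s\in S\text{ for all }0\ne s\in S\}$, and the type is $t(S)=|PF(S)|$. Put $rPF(S)=[F(S)-m(S)+1,F(S)]\setminus S$; the reduced type is $s(S)=|rPF(S)|$ (not to be confused with the integer $s=\lfloor t/2\rfloor$). Let $C(S)=\{z\in\mathbb{Z}\mid z\ge F(S)+1\}$, $K(S)=\{x\in\mathbb{Z}\mid F(S)-x\notin S\}$, and $\mathrm{tr}(K(S))=K(S)+(S-K(S))$. $S$ is far-flung Gorenstein if $\mathrm{tr}(K(S))=C(S)$. Put $\mathrm{res}(S)=|S\setminus\mathrm{tr}(K(S))|$ and $\ell(S)=|K(S)\setminus S|$. For a finite set $A\subset\mathbb{N}$ with $0\in A$, $n(A)$ is the integer such that $0,1,\dots,n(A)-1\in A+A$ and $n(A)\notin A+A$; if $0\notin A$, $n(A)=-1$. *)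

theory Defs
  imports Complex_Main "HOL-Library.Set_Algebras"
begin

text \<open>
  Numerical semigroups live inside \<open>int set\<close>, since the canonical ideal and the
  colon ideals below are sets of integers.  The pointwise sum \<open>A + B\<close> is the one
  of \<open>Set_Algebras\<close>; \<open>A - B\<close> is always set difference, and the colon
  operation has its own name.
\<close>

definition numerical_semigroup :: "int set \<Rightarrow> bool" where
  "numerical_semigroup S \<longleftrightarrow>
     S \<subseteq> {0..} \<and> 0 \<in> S \<and> (\<forall>x\<in>S. \<forall>y\<in>S. x + y \<in> S) \<and> finite ({0..} - S)"

definition multiplicity_of :: "int set \<Rightarrow> int" where
  "multiplicity_of S = (LEAST x. x \<in> S - {0})"

text \<open>The maximum is over all integers outside \<open>S\<close>, so it is \<open>-1\<close> for \<open>S = {0..}\<close>.\<close>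

definition frobenius :: "int set \<Rightarrow> int" where
  "frobenius S = (GREATEST x. x \<notin> S)"

definition pseudo_frobenius :: "int set \<Rightarrow> int set" where
  "pseudo_frobenius S = {x. x \<notin> S \<and> (\<forall>s\<in>S. s \<noteq> 0 \<longrightarrow> x + s \<in> S)}"

definition semigroup_type :: "int set \<Rightarrow> nat" where
  "semigroup_type S = card (pseudo_frobenius S)"

definition reduced_pseudo_frobenius :: "int set \<Rightarrow> int set" where
  "reduced_pseudo_frobenius S = {frobenius S - multiplicity_of S + 1..frobenius S} - S"

definition reduced_type :: "int set \<Rightarrow> nat" where
  "reduced_type S = card (reduced_pseudo_frobenius S)"

definition conductor_ideal :: "int set \<Rightarrow> int set" where
  "conductor_ideal S = {z. z \<ge> frobenius S + 1}"

definition canonical_ideal :: "int set \<Rightarrow> int set" where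
  "canonical_ideal S = {x. frobenius S - x \<notin> S}"

definition colon :: "int set \<Rightarrow> int set \<Rightarrow> int set" where
  "colon I J = {z. \<forall>y\<in>J. z + y \<in> I}"

definition canonical_trace :: "int set \<Rightarrow> int set" where
  "canonical_trace S = canonical_ideal S + colon S (canonical_ideal S)"

definition far_flung_gorenstein :: "int set \<Rightarrow> bool" where
  "far_flung_gorenstein S \<longleftrightarrow> canonical_trace S = conductor_ideal S"

definition residue :: "int set \<Rightarrow> nat" where
  "residue S = card (S - canonical_trace S)"

definition canonical_colength :: "int set \<Rightarrow> nat" where
  "canonical_colength S = card (canonical_ideal S - S)"

text \<open>
  For finite \<open>A \<subseteq> {0..}\<close> with \<open>0 \<in> A\<close> the description determines a unique
  integer once \<open>0 \<le> n\<close> is required; without it every negative \<open>n\<close> would qualify.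
\<close>

definition sumset_bound :: "int set \<Rightarrow> int" where
  "sumset_bound A =
     (if 0 \<in> A then THE n. 0 \<le> n \<and> {0..n - 1} \<subseteq> A + A \<and> n \<notin> A + A else -1)"

definition semigroup_of :: "int \<Rightarrow> int set \<Rightarrow> int set" where
  "semigroup_of n A = ({x. 0 \<le> x \<and> n \<le> x} \<union> {0}) - {(2 * n - 1) - a | a. a \<in> A}"

end

theory Submission
  imports Defs
begin

text \<open>
  The gaps of \<open>S\<close> in \<open>[n, 2n - 1]\<close> are the reflections \<open>2n - 1 - a\<close> with \<open>a \<in> A\<close>, and
  \<open>K(S) = A \<union> [n, 2n - 2] \<union> [2n, \<infinity>)\<close>. An element \<open>2n - 1 - b\<close> of \<open>S\<close> in this interval
  lies in \<open>S - K(S)\<close> only if \<open>b\<close> is not a sum of two elements of \<open>A\<close>; hence \<open>[0, n - 1] \<subseteq> A + A\<close>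
  forces \<open>S - K(S) = C(S)\<close>, so \<open>tr(K(S)) = C(S)\<close>. Counting then gives
  \<open>res(S) = n + 1 - t\<close> and \<open>\<ell>(S) = 2(t - 1)\<close>.
  For the sets \<open>A\<close> of the theorem, \<open>{0, \<dots>, s}\<close> and the multiples of \<open>s\<close> cover an interval by
  division with remainder, and the next integer is missed because it is \<open>1\<close> modulo \<open>s\<close>.
\<close>

section \<open>Sumset bound and the semigroup of a general set \<open>A\<close>\<close>

lemma sumset_bound_eqI:
  assumes "0 \<in> A" "0 \<le> n" "{0..n - 1} \<subseteq> A + A" "n \<notin> A + A"
  shows "sumset_bound A = n"
proof -
  have "(THE n. 0 \<le> n \<and> {0..n - 1} \<subseteq> A + A \<and> n \<notin> A + A) = n"
  proof (rule the_equality)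
    fix m :: int
    assume m: "0 \<le> m \<and> {0..m - 1} \<subseteq> A + A \<and> m \<notin> A + A"
    \<comment> \<open>The smaller of two distinct candidates would be covered by the other and yet
      missed.\<close>
    then have "\<not> m < n" "\<not> n < m"
      using assms by (auto simp: subset_iff)
    then show "m = n"
      by simp
  qed (use assms in simp)
  then show ?thesis
    using assms by (simp add: sumset_bound_def)
qed

text \<open>Every invariant of \<open>S\<close> is derived from these conditions alone. The bound
  \<open>n - 2\<close> keeps \<open>n - 1\<close> out of \<open>A\<close>, so \<open>n\<close> stays
  in \<open>S\<close> and becomes its multiplicity.\<close>

locale sumset_semigroup =
  fixes A :: "int set" and n :: int and S :: "int set"
  assumes A_subset: "A \<subseteq> {0..n - 2}"
    and zero_in: "0 \<in> A"
    and sums: "{0..n - 1} \<subseteq> A + A"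
    and not_sum: "n \<notin> A + A"
  defines S_def: "S \<equiv> semigroup_of n A"
begin

lemma n_ge: "n \<ge> 2"
  using A_subset zero_in by auto

lemma finite_A: "finite A"
  using A_subset by (rule finite_subset) simp

lemma in_A_bounds: "a \<in> A \<Longrightarrow> 0 \<le> a \<and> a \<le> n - 2"
  using A_subset by auto

text \<open>Serves to exclude \<open>0\<close> from the colon ideal: \<open>1\<close> is in the
  canonical ideal but not in \<open>S\<close>.\<close>

lemma one_in: "1 \<in> A"
proof -
  have "1 \<in> A + A"
    using sums n_ge by auto
  then obtain a b where ab: "a \<in> A" "b \<in> A" "1 = a + b"
    by (auto simp: set_plus_def)
  then have "a = 1 \<or> b = 1"
    using in_A_bounds[of a] in_A_bounds[of b] by linarith
  with ab show ?thesis by auto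
qed

lemma S_iff: "x \<in> S \<longleftrightarrow> x = 0 \<or> n \<le> x \<and> 2 * n - 1 - x \<notin> A"
proof -
  have "2 * n - 1 - a = x \<longleftrightarrow> a = 2 * n - 1 - x" for a
    by auto
  then have "x \<in> S \<longleftrightarrow> (x = 0 \<or> n \<le> x) \<and> 2 * n - 1 - x \<notin> A"
    using n_ge unfolding S_def semigroup_of_def by auto
  moreover have "2 * n - 1 \<notin> A"
    using in_A_bounds[of "2 * n - 1"] n_ge by auto
  ultimately show ?thesis
    by auto
qed

lemma S_large: "2 * n \<le> x \<Longrightarrow> x \<in> S"
  using in_A_bounds[of "2 * n - 1 - x"] n_ge by (auto simp: S_iff)

lemma S_ge: "x \<in> S \<Longrightarrow> x \<noteq> 0 \<Longrightarrow> n \<le> x"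
  by (simp add: S_iff)

lemma frobenius_eq: "frobenius S = 2 * n - 1"
  unfolding frobenius_def
proof (rule Greatest_equality)
  show "2 * n - 1 \<notin> S"
    using zero_in n_ge by (simp add: S_iff)
  show "y \<le> 2 * n - 1" if "y \<notin> S" for y
    using S_large[of y] that by linarith
qed

lemma multiplicity_eq: "multiplicity_of S = n"
  unfolding multiplicity_of_def
proof (rule Least_equality)
  show "n \<in> S - {0}"
    using in_A_bounds[of "n - 1"] n_ge by (auto simp: S_iff)
  show "n \<le> y" if "y \<in> S - {0}" for y
    using S_ge that by auto
qed

text \<open>Closure is automatic: two nonzero elements sum to at least \<open>2 * n\<close>, past
  the last gap.\<close>

lemma numerical_semigroup: "numerical_semigroup S"
  unfolding numerical_semigroup_def
proof (intro conjI ballI)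
  show "S \<subseteq> {0..}"
    using n_ge by (auto simp: S_iff)
  show "0 \<in> S"
    by (simp add: S_iff)
  fix x y assume "x \<in> S" "y \<in> S"
  then show "x + y \<in> S"
    using S_ge[of x] S_ge[of y] S_large[of "x + y"] by (cases "x = 0 \<or> y = 0") auto
next
  have "{0..} - S \<subseteq> {0..2 * n}"
    using S_large by (auto intro: ccontr simp: not_le)
  then show "finite ({0..} - S)"
    by (rule finite_subset) simp
qed

section \<open>Pseudo-Frobenius numbers and type\<close>

lemma reduced_pseudo_frobenius_eq: "reduced_pseudo_frobenius S = (\<lambda>a. 2 * n - 1 - a) ` A"
proof -
  have "x \<in> reduced_pseudo_frobenius S \<longleftrightarrow> 2 * n - 1 - x \<in> A" for x
    using in_A_bounds[of "2 * n - 1 - x"] n_ge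
    unfolding reduced_pseudo_frobenius_def frobenius_eq multiplicity_eq
    by (auto simp: S_iff)
  then show ?thesis
    by (force simp: image_iff)
qed

text \<open>
  If a positive \<open>x < n\<close> were pseudo-Frobenius, then \<open>A\<close> would be closed under adding \<open>x\<close> below \<open>n\<close>,
  and a decomposition of \<open>n - x\<close> in \<open>A + A\<close> would yield one of \<open>n\<close>.
\<close>

lemma small_not_pseudo_frobenius:
  assumes "0 < x" "x < n"
  shows "x \<notin> pseudo_frobenius S"
proof
  assume PF: "x \<in> pseudo_frobenius S"
  have closed: "x + a \<in> A" if "a \<in> A" "x + a < n" for a
  proof (rule ccontr)
    assume "x + a \<notin> A"
    \<comment> \<open>The reflection of \<open>x + a\<close> would lie in \<open>S\<close>, and
      adding \<open>x\<close> to it hits the gap \<open>2 * n - 1 - a\<close>.\<close>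
    then have "2 * n - 1 - a - x \<in> S" "2 * n - 1 - a - x \<noteq> 0"
      using that n_ge by (auto simp: S_iff algebra_simps)
    then have "x + (2 * n - 1 - a - x) \<in> S"
      using PF unfolding pseudo_frobenius_def by blast
    then show False
      using that in_A_bounds[of a] n_ge by (auto simp: S_iff)
  qed
  have "n - x \<in> A + A"
    using sums assms by auto
  then obtain c d where cd: "c \<in> A" "d \<in> A" "n - x = c + d"
    by (auto simp: set_plus_def)
  have "n \<in> A + A"
  proof (cases "x + c < n")
    case True
    then have "(x + c) + d \<in> A + A"
      using closed cd by (intro set_plus_intro) auto
    then show ?thesis
      using cd by (simp add: algebra_simps)
  next
    case False
    \<comment> \<open>Since \<open>x + c = n - d\<close>, only \<open>d = 0\<close> remains. Then
      \<open>x + c = n\<close> is out of reach of \<open>closed\<close>, so \<open>x\<close> is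
      added to \<open>d\<close> instead.\<close>
    then have "d = 0"
      using cd in_A_bounds[of d] by linarith
    then have "c + (x + d) \<in> A + A"
      using cd assms closed[of d] by (intro set_plus_intro) auto
    then show ?thesis
      using cd by (simp add: algebra_simps)
  qed
  with not_sum show False ..
qed

text \<open>A gap from \<open>n\<close> on reaches \<open>2 * n\<close> once a nonzero element of
  \<open>S\<close> is added, so only numbers below \<open>n\<close> have to be ruled out.\<close>

lemma pseudo_frobenius_eq: "pseudo_frobenius S = reduced_pseudo_frobenius S"
proof (intro equalityI subsetI)
  fix x assume x: "x \<in> pseudo_frobenius S"
  then have notin: "x \<notin> S" and add: "\<And>y. y \<in> S \<Longrightarrow> y \<noteq> 0 \<Longrightarrow> x + y \<in> S"
    by (auto simp: pseudo_frobenius_def)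
  have "\<not> x < 0"
  proof
    assume "x < 0"
    \<comment> \<open>For negative \<open>x\<close> the summand is at least \<open>2 * n\<close>,
      yet it carries \<open>x\<close> to the Frobenius number.\<close>
    then have "x + (2 * n - 1 - x) \<in> S"
      using n_ge by (intro add S_large) auto
    then show False
      using zero_in n_ge by (simp add: S_iff)
  qed
  moreover have "x \<noteq> 0"
    using notin by (auto simp: S_iff)
  ultimately have "n \<le> x"
    using small_not_pseudo_frobenius[of x] x by linarith
  moreover have "x \<le> 2 * n - 1"
    using S_large[of x] notin by linarith
  ultimately show "x \<in> reduced_pseudo_frobenius S"
    using notin by (simp add: reduced_pseudo_frobenius_def frobenius_eq multiplicity_eq)
next
  fix x assume "x \<in> reduced_pseudo_frobenius S"
  then have x: "n \<le> x" "x \<notin> S"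
    by (auto simp: reduced_pseudo_frobenius_def frobenius_eq multiplicity_eq)
  have "x + y \<in> S" if "y \<in> S" "y \<noteq> 0" for y
    using S_ge[OF that] x by (intro S_large) linarith
  with x show "x \<in> pseudo_frobenius S"
    by (simp add: pseudo_frobenius_def)
qed

lemma reduced_type_eq: "reduced_type S = card A"
  unfolding reduced_type_def reduced_pseudo_frobenius_eq
  by (intro card_image inj_onI) simp

lemma semigroup_type_eq: "semigroup_type S = card A"
  using reduced_type_eq
  unfolding semigroup_type_def reduced_type_def pseudo_frobenius_eq .

section \<open>Canonical ideal, trace, residue and colength\<close>

lemma conductor_ideal_eq: "conductor_ideal S = {2 * n..}"
  by (auto simp: conductor_ideal_def frobenius_eq)

text \<open>From \<open>n\<close> on, the reflection \<open>2 * n - 1 - x\<close> is below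
  \<open>n\<close>, hence outside \<open>S\<close> unless it is \<open>0\<close>; below
  \<open>n\<close>, the reflected gaps give back \<open>A\<close>.\<close>

lemma canonical_ideal_iff:
  "x \<in> canonical_ideal S \<longleftrightarrow> x \<in> A \<or> n \<le> x \<and> x \<noteq> 2 * n - 1"
  using in_A_bounds[of x] in_A_bounds[of "2 * n - 1"] n_ge
  by (auto simp: canonical_ideal_def frobenius_eq S_iff)

lemma canonical_ideal_nonneg: "x \<in> canonical_ideal S \<Longrightarrow> 0 \<le> x"
  using in_A_bounds[of x] n_ge by (auto simp: canonical_ideal_iff)

lemma colon_canonical_ideal: "colon S (canonical_ideal S) = {2 * n..}"
proof (intro equalityI subsetI)
  fix z assume "z \<in> colon S (canonical_ideal S)"
  then have z: "z + y \<in> S" if "y \<in> A" for y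
    using that by (auto simp: colon_def canonical_ideal_iff)
  have "z \<in> S"
    using z[OF zero_in] by simp
  moreover have "z \<noteq> 0"
    using z[OF one_in] n_ge by (auto simp: S_iff)
  ultimately have "n \<le> z"
    by (rule S_ge)
  show "z \<in> {2 * n..}"
  proof (rule ccontr)
    assume "z \<notin> {2 * n..}"
    \<comment> \<open>From \<open>n <= z < 2 * n\<close> the reflection of \<open>z\<close> falls
      into the covered interval \<open>[0, n - 1]\<close>.\<close>
    then have "2 * n - 1 - z \<in> A + A"
      using sums \<open>n \<le> z\<close> by auto
    then obtain a b where ab: "a \<in> A" "b \<in> A" "2 * n - 1 - z = a + b"
      by (auto simp: set_plus_def)
    then have "2 * n - 1 - (z + a) = b"
      by linarith
    moreover have "z + a \<noteq> 0"
      using in_A_bounds[OF ab(1)] n_ge \<open>n \<le> z\<close> by linarith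
    ultimately show False
      using z[OF ab(1)] ab(2) by (simp add: S_iff)
  qed
next
  fix z assume "z \<in> {2 * n..}"
  then show "z \<in> colon S (canonical_ideal S)"
    using S_large canonical_ideal_nonneg by (force simp: colon_def)
qed

text \<open>The canonical ideal contains \<open>0\<close> and nothing negative, so adding it leaves
  the ray \<open>{2 * n..}\<close> unchanged.\<close>

lemma canonical_trace_eq: "canonical_trace S = {2 * n..}"
proof -
  have "canonical_ideal S + {2 * n..} = {2 * n..}"
  proof (intro equalityI subsetI)
    fix x assume "x \<in> canonical_ideal S + {2 * n..}"
    then show "x \<in> {2 * n..}"
      using canonical_ideal_nonneg by (force simp: set_plus_def)
  next
    fix x assume "x \<in> {2 * n..}"
    then have "0 + x \<in> canonical_ideal S + {2 * n..}"
      using zero_in by (intro set_plus_intro) (auto simp: canonical_ideal_iff)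
    then show "x \<in> canonical_ideal S + {2 * n..}"
      by simp
  qed
  then show ?thesis
    by (simp add: canonical_trace_def colon_canonical_ideal)
qed

lemma far_flung_gorenstein: "far_flung_gorenstein S"
  by (simp add: far_flung_gorenstein_def canonical_trace_eq conductor_ideal_eq)

lemma residue_eq: "int (residue S) = n + 1 - int (card A)"
proof -
  have sub: "(\<lambda>a. 2 * n - 1 - a) ` A \<subseteq> {n..2 * n - 1}"
    using in_A_bounds n_ge by force
  have "x \<in> S - {2 * n..} \<longleftrightarrow> x \<in> insert 0 ({n..2 * n - 1} - (\<lambda>a. 2 * n - 1 - a) ` A)" for x
    using n_ge by (force simp: S_iff image_iff)
  then have "S - {2 * n..} = insert 0 ({n..2 * n - 1} - (\<lambda>a. 2 * n - 1 - a) ` A)"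
    by blast
  then have "residue S = Suc (card ({n..2 * n - 1} - (\<lambda>a. 2 * n - 1 - a) ` A))"
    using n_ge by (simp add: residue_def canonical_trace_eq)
  also have "card ({n..2 * n - 1} - (\<lambda>a. 2 * n - 1 - a) ` A)
      = card {n..2 * n - 1} - card ((\<lambda>a. 2 * n - 1 - a) ` A)"
    using sub finite_A by (intro card_Diff_subset) auto
  also have "card ((\<lambda>a. 2 * n - 1 - a) ` A) = card A"
    by (intro card_image inj_onI) simp
  finally have "residue S = Suc (nat n - card A)"
    by simp
  \<comment> \<open>This makes the truncated subtraction of naturals exact.\<close>
  moreover have "card A \<le> card {0..n - 2}"
    using A_subset by (intro card_mono) auto
  ultimately show ?thesis
    using n_ge by simp
qed

text \<open>Each nonzero \<open>a\<close> in \<open>A\<close> contributes itself and its reflection,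
  which lie on opposite sides of \<open>n\<close>; \<open>0\<close> contributes nothing, as
  \<open>0\<close> is in \<open>S\<close> and \<open>2 * n - 1\<close> is not canonical.\<close>

lemma canonical_colength_eq: "int (canonical_colength S) = 2 * (int (card A) - 1)"
proof -
  let ?B = "A - {0}"
  have image: "x \<in> (\<lambda>a. 2 * n - 1 - a) ` ?B \<longleftrightarrow> 2 * n - 1 - x \<in> ?B" for x
    by (auto intro: image_eqI[where x = "2 * n - 1 - x"])
  have "x \<in> canonical_ideal S - S \<longleftrightarrow> x \<in> ?B \<union> (\<lambda>a. 2 * n - 1 - a) ` ?B" for x
    using in_A_bounds[of x] in_A_bounds[of "2 * n - 1 - x"] n_ge
    unfolding Un_iff image by (auto simp: canonical_ideal_iff S_iff)
  then have "canonical_ideal S - S = ?B \<union> (\<lambda>a. 2 * n - 1 - a) ` ?B"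
    by blast
  moreover have "?B \<inter> (\<lambda>a. 2 * n - 1 - a) ` ?B = {}"
    unfolding disjoint_iff image by (auto dest!: in_A_bounds)
  ultimately have "canonical_colength S = card ?B + card ((\<lambda>a. 2 * n - 1 - a) ` ?B)"
    using finite_A by (simp add: canonical_colength_def card_Un_disjoint)
  also have "card ((\<lambda>a. 2 * n - 1 - a) ` ?B) = card ?B"
    by (intro card_image inj_onI) simp
  finally have "canonical_colength S = 2 * card ?B"
    by simp
  moreover have "int (card ?B) = int (card A) - 1"
    using zero_in finite_A card_gt_0_iff[of A] by (auto simp: card_Diff_singleton of_nat_diff)
  ultimately show ?thesis by simp
qed

end

section \<open>Intervals extended by multiples\<close>

text \<open>With \<open>m = s\<close> and \<open>m = s + 1\<close> these are the sets of the theorem for even and odd \<open>t\<close>.\<close>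

definition interval_multiples :: "int \<Rightarrow> int \<Rightarrow> int set" where
  "interval_multiples s m = {0..s} \<union> {k * s | k. k \<in> {2..m}}"

lemma multiple_in_interval_multiples:
  "0 \<le> k \<Longrightarrow> k \<le> m \<Longrightarrow> 0 \<le> s \<Longrightarrow> k * s \<in> interval_multiples s m"
proof -
  assume k: "0 \<le> k" "k \<le> m" "0 \<le> s"
  then consider "k = 0" | "k = 1" | "k \<in> {2..m}"
    by fastforce
  then show ?thesis
    using k by cases (auto simp: interval_multiples_def)
qed

lemma interval_multiples_bounds:
  assumes "2 \<le> s" "2 \<le> m" "x \<in> interval_multiples s m"
  shows "0 \<le> x \<and> x \<le> m * s"
proof -
  have "s \<le> m * s"
    using assms mult_right_mono[of 1 m s] by simp
  moreover have "0 \<le> k * s \<and> k * s \<le> m * s" if "k \<in> {2..m}" for k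
    using assms that by (simp add: mult_right_mono)
  ultimately show ?thesis
    using assms(3) by (force simp: interval_multiples_def)
qed

lemma card_interval_multiples:
  assumes "2 \<le> s" "2 \<le> m"
  shows "int (card (interval_multiples s m)) = s + m"
proof -
  have eq: "interval_multiples s m = {0..s} \<union> (\<lambda>k. k * s) ` {2..m}"
    by (auto simp: interval_multiples_def)
  have "s < k * s" if "2 \<le> k" for k
    using that assms mult_right_mono[of 2 k s] by linarith
  then have "{0..s} \<inter> (\<lambda>k. k * s) ` {2..m} = {}"
    by fastforce
  moreover have "card ((\<lambda>k. k * s) ` {2..m}) = card {2..m}"
    using assms by (intro card_image inj_onI) simp
  ultimately show ?thesis
    using assms by (simp add: eq card_Un_disjoint)
qed

lemma interval_multiples_sums:
  assumes "2 \<le> s" "2 \<le> m"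
  shows "{0..m * s + s} \<subseteq> interval_multiples s m + interval_multiples s m"
proof
  fix x assume x: "x \<in> {0..m * s + s}"
  have small: "r \<in> interval_multiples s m" if "0 \<le> r" "r \<le> s" for r
    using that by (simp add: interval_multiples_def)
  show "x \<in> interval_multiples s m + interval_multiples s m"
  proof (cases "m * s \<le> x")
    case True
    \<comment> \<open>At \<open>x = m * s + s\<close> the quotient by \<open>s\<close> would be
      \<open>m + 1\<close>, so the top multiple is kept fixed and the rest may equal
      \<open>s\<close>.\<close>
    then have "m * s + (x - m * s) \<in> interval_multiples s m + interval_multiples s m"
      using x assms by (intro set_plus_intro multiple_in_interval_multiples small) auto
    then show ?thesis by simp
  next
    case False
    have "x div s * s + x mod s \<in> interval_multiples s m + interval_multiples s m"
    proof (intro set_plus_intro multiple_in_interval_multiples small)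
      show "0 \<le> x div s"
        using x assms by (simp add: pos_imp_zdiv_nonneg_iff)
      have "x div s \<le> m * s div s"
        using False assms by (intro zdiv_mono1) auto
      then show "x div s \<le> m"
        using assms by simp
      show "x mod s \<le> s"
        using assms pos_mod_bound[of s x] by linarith
    qed (use assms in auto)
    then show ?thesis by simp
  qed
qed

text \<open>A summand at most \<open>s\<close> would leave at least \<open>m * s + 1\<close>, beyond
  the maximum. So both summands are multiples of \<open>s\<close>, while the target is
  \<open>1\<close> modulo \<open>s\<close>.\<close>

lemma interval_multiples_not_sum:
  assumes "2 \<le> s" "2 \<le> m"
  shows "m * s + s + 1 \<notin> interval_multiples s m + interval_multiples s m"
proof
  assume "m * s + s + 1 \<in> interval_multiples s m + interval_multiples s m"
  then obtain a b where ab: "a \<in> interval_multiples s m" "b \<in> interval_multiples s m"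
    "m * s + s + 1 = a + b"
    by (auto simp: set_plus_def)
  then have "\<not> a \<le> s" "\<not> b \<le> s"
    using interval_multiples_bounds[OF assms] by fastforce+
  with ab have "s dvd a" "s dvd b"
    by (auto simp: interval_multiples_def)
  then have "s dvd a + b - (m + 1) * s"
    by simp
  moreover have "a + b - (m + 1) * s = 1"
    using ab(3) by (simp add: algebra_simps)
  ultimately show False
    using assms by simp
qed

lemma interval_multiples_properties:
  fixes s m :: int
  assumes "2 \<le> s" "2 \<le> m"
  defines "A \<equiv> interval_multiples s m"
  shows "sumset_bound A = m * s + s + 1"
    and "Max A + 2 \<le> m * s + s + 1"
    and "sumset_semigroup A (m * s + s + 1)"
proof -
  have pos: "0 \<le> m * s"
    using assms by simp
  have zero: "0 \<in> A"
    using assms by (simp add: interval_multiples_def)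
  have bounds: "A \<subseteq> {0..m * s}"
    using interval_multiples_bounds[OF assms(1,2)] by (auto simp: A_def)
  have sums: "{0..m * s + s + 1 - 1} \<subseteq> A + A"
    using interval_multiples_sums[OF assms(1,2)] by (simp add: A_def)
  have not_sum: "m * s + s + 1 \<notin> A + A"
    using interval_multiples_not_sum[OF assms(1,2)] by (simp add: A_def)
  show "sumset_bound A = m * s + s + 1"
    using zero pos assms(1) sums not_sum by (intro sumset_bound_eqI) auto
  have "finite A"
    using bounds by (rule finite_subset) simp
  then have "Max A \<in> A"
    using zero by (intro Max_in) auto
  then show "Max A + 2 \<le> m * s + s + 1"
    using bounds assms(1) by auto
  show "sumset_semigroup A (m * s + s + 1)"
    using zero sums not_sum bounds assms(1) by unfold_locales auto
qed

theorem proposition3: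
  fixes t s :: int and A S :: "int set"
  assumes "t \<ge> 4"
    and "s = \<lfloor>real_of_int t / 2\<rfloor>"
    and "A = (if even t then {0..s} \<union> {k * s | k. k \<in> {2..s}}
                        else {0..s} \<union> {k * s | k. k \<in> {2..s + 1}})"
    and "S = semigroup_of (sumset_bound A) A"
  shows "int (card A) = t
     \<and> ((even t \<longrightarrow> sumset_bound A = s^2 + s + 1 \<and>
             real_of_int (s^2 + s + 1) = (real_of_int t)^2 / 4 + real_of_int t / 2 + 1) \<and>
        (odd t \<longrightarrow> sumset_bound A = s^2 + 2 * s + 1 \<and>
             real_of_int (s^2 + 2 * s + 1) = (real_of_int t)^2 / 4 + real_of_int t / 2 + 1 / 4) \<and>
        Max A + 2 \<le> sumset_bound A)
     \<and> (t \<ge> 9 \<longrightarrow> 3 * (t - 1) < sumset_bound A)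
     \<and> (numerical_semigroup S \<and> far_flung_gorenstein S \<and>
        reduced_type S = semigroup_type S \<and> int (semigroup_type S) = t \<and>
        (t \<ge> 9 \<longrightarrow> residue S > canonical_colength S))"
proof -
  \<comment> \<open>Treats both parities at once: \<open>t = s + m\<close> and the bound is
    \<open>m * s + s + 1\<close>.\<close>
  define m where "m = (if even t then s else s + 1)"
  have s_div: "s = t div 2"
    using assms(2) floor_divide_of_int_eq[of t 2, where ?'a = real] by simp
  have cases: "even t \<Longrightarrow> t = 2 * s \<and> m = s" "odd t \<Longrightarrow> t = 2 * s + 1 \<and> m = s + 1"
    using s_div by (auto simp: m_def)
  then have t_eq: "t = s + m" and s: "2 \<le> s" and m: "2 \<le> m"
    using assms(1) s_div by fastforce+
  have A_eq: "A = interval_multiples s m"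
    by (simp add: assms(3) m_def interval_multiples_def)
  note props = interval_multiples_properties[OF s m, folded A_eq]
  interpret sumset_semigroup A "m * s + s + 1" S
    rewrites "semigroup_of (m * s + s + 1) A = S"
    using props(3) assms(4) by (simp_all add: props(1))
  have card: "int (card A) = t"
    using card_interval_multiples[OF s m] by (simp add: A_eq t_eq)
  have even: "sumset_bound A = s^2 + s + 1 \<and>
      real_of_int (s^2 + s + 1) = (real_of_int t)^2 / 4 + real_of_int t / 2 + 1" if "even t"
    using cases that by (simp add: props(1) power2_eq_square field_simps)
  have odd: "sumset_bound A = s^2 + 2 * s + 1 \<and>
      real_of_int (s^2 + 2 * s + 1) = (real_of_int t)^2 / 4 + real_of_int t / 2 + 1 / 4" if "odd t"
    using cases that by (simp add: props(1) power2_eq_square field_simps)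
  \<comment> \<open>In both parities \<open>t >= 9\<close> forces \<open>m >= 5\<close>, and
    \<open>3 * (t - 1)\<close> is at most \<open>6 * s\<close>.\<close>
  have large: "3 * (t - 1) < m * s + s + 1" if "t \<ge> 9"
  proof (cases "even t")
    case True
    then have "5 \<le> s" and eqs: "t = 2 * s" "m = s"
      using cases that by auto
    have "3 * (t - 1) < 5 * s + s + 1"
      by (simp add: eqs)
    also have "\<dots> \<le> m * s + s + 1"
      using \<open>5 \<le> s\<close> by (simp add: eqs)
    finally show ?thesis .
  next
    case False
    then have "5 \<le> m" and eqs: "t = 2 * s + 1" "m = s + 1"
      using cases that by auto
    have "3 * (t - 1) < 5 * s + s + 1"
      using s by (simp add: eqs)
    also have "\<dots> \<le> m * s + s + 1"
      using \<open>5 \<le> m\<close> s by (simp add: mult_right_mono)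
    finally show ?thesis .
  qed
  \<comment> \<open>With \<open>n = m * s + s + 1\<close>, the claim
    \<open>n + 1 - t > 2 * (t - 1)\<close> is exactly \<open>large\<close>.\<close>
  then have "residue S > canonical_colength S" if "t \<ge> 9"
    using that residue_eq canonical_colength_eq card by fastforce
  then show ?thesis
    using card even odd props(1,2) large numerical_semigroup far_flung_gorenstein
      reduced_type_eq semigroup_type_eq by simp
qed

end
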